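(* Let $n\ge 0$ and $v\in\mathrm{Sym}[n]$. The Fishburn basis of $v$ is the set of $v$-compatible maps that are Cayley permutations: $$B(v)=\mathrm{Cay}[n]\cap\mathrm{Comp}(v).$$
   Context: Let $[n]=\{1,\dots,n\}$. Maps $x:[n]\to[m]$ are identified with words $x_1\cdots x_n$, $x_i=x(i)$, of positive integers. A Cayley permutation on $[n]$ is a map $x:[n]\to[n]$ with image $[k]$ for some $k\le n$. $\mathrm{Cay}[n]$ is the set of Cayley permutations on $[n]$, $\mathrm{Sym}[n]$ the set of permutations of $[n]$, and $\mathrm{I}[n]$ the set of weakly increasing Cayley permutations on $[n]$. For a word $v$ of length $n$: $D(v)=\{i\in[n-1]: v(i)\ge v(i+1)\}$ and, for a permutation $v$, $A(v)=\{i\in[n-1]: v(i)<v(i+1)\}$. Given words $u,v$ of positive integers of equal length $n$, with $u$ weakly increasing and $D(u)\subseteq D(v)$, let $\Gamma(u,v)$ be the word obtained as follows: take the $n$ columns $\binom{v_i}{u_i}$ (top entry $v_i$, bottom entry $u_i$), sort them in ascending order of top entry, breaking ties by descending order of bottom entry, and read off the bottom row. For $v\in\mathrm{Sym}[n]$, let $\mathrm{I}(v)=\{u\in\mathrm{I}[n]: D(u)\subseteq D(v)\}$; the Fishburn basis of $v$ is $B(v)=\{\Gamma(u,v): u\in\mathrm{I}(v)\}$. For $v\in\mathrm{Sym}[n]$ and $m\ge0$, a map $x:[n]\to[m]$ is $v$-compatible if $x(v_1)\le x(v_2)\le\cdots\le x(v_n)$ and $x(v_i)<x(v_{i+1})$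 for each $i\in A(v)$. $\mathrm{Comp}_m(v)$ is the set of $v$-compatible maps $[n]\to[m]$ and $\mathrm{Comp}(v)=\bigcup_{m\ge 0}\mathrm{Comp}_m(v)$ (as a set of words). *)

theory Defs
  imports Main "HOL-Library.Product_Lexorder" "HOL-Combinatorics.Multiset_Permutations"
begin

text \<open>A map \<open>x : [n] \<rightarrow> [m]\<close> is represented by the list \<open>x(1) \<dots> x(n)\<close> of its values, so that all
  positions and letters are counted from 1.\<close>

definition letter :: "nat list \<Rightarrow> nat \<Rightarrow> nat" where
  "letter w i = w ! (i - 1)"

definition Maps :: "nat \<Rightarrow> nat \<Rightarrow> nat list set" where
  "Maps n m = {x. length x = n \<and> set x \<subseteq> {1..m}}"

definition Cay :: "nat \<Rightarrow> nat list set" where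
  "Cay n = {x \<in> Maps n n. \<exists>k\<le>n. set x = {1..k}}"

definition Sym :: "nat \<Rightarrow> nat list set" where
  "Sym n = permutations_of_set {1..n}"

definition Inc :: "nat \<Rightarrow> nat list set" where
  "Inc n = {u \<in> Cay n. sorted u}"

definition weak_descents :: "nat list \<Rightarrow> nat set" where
  "weak_descents w = {i \<in> {1..length w - 1}. letter w i \<ge> letter w (i + 1)}"

definition ascents :: "nat list \<Rightarrow> nat set" where
  "ascents w = {i \<in> {1..length w - 1}. letter w i < letter w (i + 1)}"

text \<open>The columns are the pairs \<open>(t, b)\<close> of top and bottom entry. Pairs of integers are compared lexicographically,
  so negating the bottom entry breaks ties by descending bottom entry. The map is only
  meaningful for words of equal length with \<open>u\<close> weakly increasing and
  \<open>weak_descents u \<subseteq> weak_descents v\<close>.\<close>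

definition Gamma_word :: "nat list \<Rightarrow> nat list \<Rightarrow> nat list" where
  "Gamma_word u v =
     map snd (sort_key (\<lambda>(t, b). (int t, - int b)) (zip v u))"

definition Inc_of :: "nat list \<Rightarrow> nat list set" where
  "Inc_of v = {u \<in> Inc (length v). weak_descents u \<subseteq> weak_descents v}"

definition Fishburn_basis :: "nat list \<Rightarrow> nat list set" where
  "Fishburn_basis v = {Gamma_word u v | u. u \<in> Inc_of v}"

definition compatible :: "nat list \<Rightarrow> nat list \<Rightarrow> bool" where
  "compatible v x \<longleftrightarrow>
     (\<forall>i\<in>{1..length v - 1}. letter x (letter v i) \<le> letter x (letter v (i + 1))) \<and>
     (\<forall>i\<in>ascents v. letter x (letter v i) < letter x (letter v (i + 1)))"

definition Comp_bounded :: "nat \<Rightarrow> nat list \<Rightarrow> nat list set" where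
  "Comp_bounded m v = {x \<in> Maps (length v) m. compatible v x}"

definition Comp :: "nat list \<Rightarrow> nat list set" where
  "Comp v = (\<Union>m. Comp_bounded m v)"

end

theory Submission
  imports Defs
begin

text \<open>
  A permutation \<open>v\<close> has pairwise distinct top entries, so ties never occur in the definition of
  \<open>\<Gamma>(u, v)\<close>: sorting the columns puts the column with top entry \<open>j\<close> in position \<open>j\<close>. Hence
  \<open>x = \<Gamma>(u, v)\<close> is the word with \<open>x(v_i) = u_i\<close>, that is, \<open>\<Gamma>(_, v)\<close> inverts the rearrangement
  \<open>x \<mapsto> x(v_1) \<dots> x(v_n)\<close> of words of length \<open>n\<close> (lemmas \<open>map_letter_Gamma_word\<close> and
  \<open>Gamma_word_map_letter\<close>).

  So \<open>x \<in> B(v)\<close> says that the rearranged word \<open>u = x(v_1) \<dots> x(v_n)\<close> lies in \<open>I(v)\<close>. Rearranging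
  preserves the set of letters, hence the property of being a Cayley permutation. Finally, the weak
  inequalities of \<open>v\<close>-compatibility express that \<open>u\<close> is weakly increasing, and the strict ones that
  every ascent of \<open>v\<close> is an ascent of \<open>u\<close>, which by complementation in \<open>[n - 1]\<close> is the inclusion
  \<open>D(u) \<subseteq> D(v)\<close> (lemma \<open>compatible_iff\<close>).
\<close>

lemma SymD:
  assumes "v \<in> Sym n"
  shows "length v = n" "set v = {1..n}" "distinct v"
proof -
  show v: "set v = {1..n}" "distinct v"
    using assms by (auto simp: Sym_def dest: permutations_of_setD)
  show "length v = n"
    using distinct_card[OF v(2)] v(1) by simp
qed

lemma set_letters: "letter x ` {1..length x} = set x"
proof -
  have "letter x ` {1..length x} = (!) x ` ((\<lambda>i. i - 1) ` {1..length x})"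
    by (simp add: letter_def image_image)
  also have "(\<lambda>i. i - 1) ` {1..length x} = {0..<length x}"
    by (force simp: image_iff intro: bexI[of _ "Suc _"])
  finally show ?thesis
    using nth_image[of "length x" x] by simp
qed

lemma set_map_letter:
  assumes "v \<in> Sym n" "length x = n"
  shows "set (map (letter x) v) = set x"
  using set_letters[of x] SymD[OF assms(1)] assms(2) by simp

lemma letter_map_letter:
  assumes "i \<in> {1..length v}"
  shows "letter (map (letter x) v) i = letter x (letter v i)"
proof -
  have "i - 1 < length v" using assms by auto
  thus ?thesis by (simp add: letter_def)
qed

lemma mem_Cay_iff: "x \<in> Cay n \<longleftrightarrow> length x = n \<and> (\<exists>k\<le>n. set x = {1..k})"
  by (auto simp: Cay_def Maps_def)

lemma length_Gamma_word: "length u = length v \<Longrightarrow> length (Gamma_word u v) = length u"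
  by (simp add: Gamma_word_def)

text \<open>After sorting, the top row is the sorted arrangement of \<open>v\<close>, which is \<open>1 2 \<dots> n\<close>; so the
  position of a column in the sorted list is its top entry.\<close>

lemma map_letter_Gamma_word:
  assumes v: "v \<in> Sym n" and u: "length u = n"
  shows "map (letter (Gamma_word u v)) v = u"
proof (rule nth_equalityI)
  note v' = SymD[OF v]
  define key where "key = (\<lambda>(t::nat, b::nat). (int t, - int b))"
  define ys where "ys = sort_key key (zip v u)"
  have G: "Gamma_word u v = map snd ys"
    by (simp add: Gamma_word_def ys_def key_def)
  have len: "length ys = n"
    by (simp add: ys_def v' u)
  have "sorted (map key ys)"
    by (simp add: ys_def)
  hence "sorted (map fst ys)"
    unfolding sorted_map by (rule sorted_wrt_mono_rel[rotated]) (auto simp: key_def)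
  moreover have mset_tops: "mset (map fst ys) = mset v"
  proof -
    have "mset (map fst ys) = mset (map fst (zip v u))"
      by (simp add: ys_def)
    thus ?thesis by (simp add: v' u)
  qed
  have "set (map fst ys) = {1..n}" "distinct (map fst ys)"
    using mset_eq_setD[OF mset_tops] mset_eq_imp_distinct_iff[OF mset_tops] v' by auto
  ultimately have tops: "map fst ys = [1..<Suc n]"
    by (intro sorted_distinct_set_unique) (auto simp del: upt_Suc)
  show "length (map (letter (Gamma_word u v)) v) = length u"
    by (simp add: v' u)
  fix i assume "i < length (map (letter (Gamma_word u v)) v)"
  hence i: "i < n" by (simp add: v')
  hence "(v ! i, u ! i) \<in> set ys"
    by (force simp: ys_def set_zip v' u)
  then obtain j where j: "j < n" "ys ! j = (v ! i, u ! i)"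
    by (auto simp: in_set_conv_nth len)
  have "v ! i = map fst ys ! j"
    using j len by simp
  also have "\<dots> = Suc j"
    using j(1) by (simp add: tops del: upt_Suc)
  finally show "map (letter (Gamma_word u v)) v ! i = u ! i"
    using i j len by (simp add: G letter_def v')
qed

text \<open>Since \<open>v\<close> reaches every position, a word is determined by its rearrangement along \<open>v\<close>; so the
  left inverse \<open>\<Gamma>(_, v)\<close> is two-sided.\<close>

lemma Gamma_word_map_letter:
  assumes v: "v \<in> Sym n" and x: "length x = n"
  shows "Gamma_word (map (letter x) v) v = x"
proof (rule nth_equalityI)
  note v' = SymD[OF v]
  let ?y = "Gamma_word (map (letter x) v) v"
  show len: "length ?y = length x"
    by (simp add: length_Gamma_word v' x)
  have eq: "map (letter ?y) v = map (letter x) v"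
    using map_letter_Gamma_word[OF v] by (simp add: v')
  fix i assume "i < length ?y"
  hence "Suc i \<in> set v"
    using len by (simp add: v' x)
  hence "letter ?y (Suc i) = letter x (Suc i)"
    using eq by (simp only: map_eq_conv)
  thus "?y ! i = x ! i"
    by (simp add: letter_def)
qed

lemma Fishburn_basis_iff:
  assumes v: "v \<in> Sym n"
  shows "x \<in> Fishburn_basis v \<longleftrightarrow> length x = n \<and> map (letter x) v \<in> Inc_of v"
proof
  assume "x \<in> Fishburn_basis v"
  then obtain u where u: "u \<in> Inc_of v" and x: "x = Gamma_word u v"
    by (auto simp: Fishburn_basis_def)
  have "length u = n"
    using u SymD[OF v] by (auto simp: Inc_of_def Inc_def mem_Cay_iff)
  thus "length x = n \<and> map (letter x) v \<in> Inc_of v"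
    using u x map_letter_Gamma_word[OF v] by (simp add: length_Gamma_word SymD[OF v])
next
  assume "length x = n \<and> map (letter x) v \<in> Inc_of v"
  thus "x \<in> Fishburn_basis v"
    using Gamma_word_map_letter[OF v, of x] unfolding Fishburn_basis_def by force
qed

lemma sorted_iff_letter:
  "sorted w \<longleftrightarrow> (\<forall>i\<in>{1..length w - 1}. letter w i \<le> letter w (i + 1))"
proof
  assume "sorted w"
  thus "\<forall>i\<in>{1..length w - 1}. letter w i \<le> letter w (i + 1)"
    by (auto simp: letter_def intro!: sorted_nth_mono)
next
  assume *: "\<forall>i\<in>{1..length w - 1}. letter w i \<le> letter w (i + 1)"
  show "sorted w"
    unfolding sorted_iff_nth_Suc
  proof (intro allI impI)
    fix i assume "Suc i < length w"
    thus "w ! i \<le> w ! Suc i"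
      using bspec[OF *, of "Suc i"] by (simp add: letter_def)
  qed
qed

lemma compatible_iff:
  "compatible v x \<longleftrightarrow>
     sorted (map (letter x) v) \<and> weak_descents (map (letter x) v) \<subseteq> weak_descents v"
proof -
  let ?u = "map (letter x) v"
  have u: "letter x (letter v i) = letter ?u i" "letter x (letter v (i + 1)) = letter ?u (i + 1)"
    if "i \<in> {1..length v - 1}" for i
    using that by (auto intro!: letter_map_letter[symmetric])
  have "(\<forall>i\<in>{1..length v - 1}. letter x (letter v i) \<le> letter x (letter v (i + 1)))
          \<longleftrightarrow> sorted ?u"
    unfolding sorted_iff_letter length_map by (intro ball_cong refl) (simp only: u)
  \<comment> \<open>Both sides of the next equivalence say that no \<open>i\<close> is a weak descent of \<open>u\<close> and an ascent of
    \<open>v\<close> at once.\<close>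
  moreover have "(\<forall>i\<in>ascents v. letter x (letter v i) < letter x (letter v (i + 1)))
          \<longleftrightarrow> weak_descents ?u \<subseteq> weak_descents v"
  proof -
    have "(\<forall>i\<in>ascents v. letter x (letter v i) < letter x (letter v (i + 1)))
            \<longleftrightarrow> (\<forall>i\<in>ascents v. letter ?u i < letter ?u (i + 1))"
      by (intro ball_cong refl) (simp only: u ascents_def mem_Collect_eq)
    also have "\<dots> \<longleftrightarrow> weak_descents ?u \<subseteq> weak_descents v"
      unfolding ascents_def weak_descents_def length_map subset_iff mem_Collect_eq Ball_def
      by (meson not_le)
    finally show ?thesis .
  qed
  ultimately show ?thesis
    unfolding compatible_def by simp
qed

theorem corollary7p3:
  fixes n :: nat and v :: "nat list"
  assumes "v \<in> Sym n"
  shows "Fishburn_basis v = Cay n \<inter> Comp v"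
proof (rule set_eqI)
  fix x
  note v = SymD[OF assms]
  have Cay: "map (letter x) v \<in> Cay n \<longleftrightarrow> x \<in> Cay n" if "length x = n"
    unfolding mem_Cay_iff set_map_letter[OF assms that] by (simp add: that v)
  have "x \<in> Fishburn_basis v \<longleftrightarrow> x \<in> Cay n \<and> compatible v x"
    unfolding Fishburn_basis_iff[OF assms] Inc_of_def Inc_def compatible_iff
    using Cay by (auto simp: v mem_Cay_iff[of x])
  \<comment> \<open>The letters of a Cayley permutation on \<open>[n]\<close> are at most \<open>n\<close>, so it is a map into \<open>[m]\<close> for
    \<open>m = n\<close>.\<close>
  also have "\<dots> \<longleftrightarrow> x \<in> Cay n \<inter> Comp v"
    by (auto simp: Comp_def Comp_bounded_def v Cay_def)
  finally show "x \<in> Fishburn_basis v \<longleftrightarrow> x \<in> Cay n \<inter> Comp v" .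
qed

end
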